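(* Let $f:\mathbb{R}\to\mathbb{R}$ be the strongly convex smooth function $f(x)=\ln(1+e^x)+\frac{x^2}{200}$, and let $F(x)=\nabla f(x)=f'(x)$, which is monotone and Lipschitz. Then the Hamiltonian operator $F_{\mathcal{H}}(x)=\nabla F(x)^\top F(x)$, i.e. $F_{\mathcal H}(x)=F'(x)F(x)$, is non-cocoercive: it is not $\ell$-cocoercive for any $\ell>0$.
   Context: For $\ell>0$, an operator $G:\mathbb{R}^d\to\mathbb{R}^d$ is $\ell$-cocoercive if $\|G(x)-G(x')\|^2\le\ell\langle G(x)-G(x'),x-x'\rangle$ for all $x,x'\in\mathbb{R}^d$ (here $d=1$). $G$ is monotone if $\langle G(x)-G(x'),x-x'\rangle\ge0$ for all $x,x'$. *)

theory Defs
  imports "HOL-Analysis.Analysis"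
begin

definition cocoercive :: "real \<Rightarrow> ('a::euclidean_space \<Rightarrow> 'a) \<Rightarrow> bool" where
  "cocoercive l G \<longleftrightarrow> (\<forall>x x'. (norm (G x - G x'))\<^sup>2 \<le> l * ((G x - G x') \<bullet> (x - x')))"

(* Monotone in the sense of operator theory, as opposed to the order-theoretic constant mono. *)
definition monotone_operator :: "('a::euclidean_space \<Rightarrow> 'a) \<Rightarrow> bool" where
  "monotone_operator G \<longleftrightarrow> (\<forall>x x'. (G x - G x') \<bullet> (x - x') \<ge> 0)"

definition strongly_convex :: "real \<Rightarrow> ('a::euclidean_space \<Rightarrow> real) \<Rightarrow> bool" where
  "strongly_convex m f \<longleftrightarrow> m > 0 \<and>
    (\<forall>x y. \<forall>u\<ge>0. \<forall>v\<ge>0. u + v = 1 \<longrightarrow>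
      f (u *\<^sub>R x + v *\<^sub>R y) \<le> u * f x + v * f y - m / 2 * u * v * (norm (x - y))\<^sup>2)"

(* Smoothness in the sense of optimization: differentiable with an L-Lipschitz gradient. *)
definition L_smooth :: "real \<Rightarrow> (real \<Rightarrow> real) \<Rightarrow> bool" where
  "L_smooth L f \<longleftrightarrow> (\<forall>x. f field_differentiable at x) \<and> L-lipschitz_on UNIV (deriv f)"

(* The operator (DF)^T F in dimension one, where the transposed Jacobian is the derivative.
   Meaningful for everywhere differentiable F only, since deriv is a total function. *)
definition hamiltonian_operator :: "(real \<Rightarrow> real) \<Rightarrow> real \<Rightarrow> real" where
  "hamiltonian_operator F x = deriv F x * F x"

end

theory Submission
  imports Defs
begin

text \<open>Cocoercivity would force monotonicity of the Hamiltonian operator \<open>F' F\<close>.  But \<open>F' F\<close> is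
  \<open>0.13\<close> at \<open>0\<close>, where the logistic part of \<open>F\<close> is steepest, and below \<open>0.04\<close> at \<open>100\<close>, where
  the logistic function has saturated and \<open>F'\<close> is hardly more than the slope \<open>1/100\<close> coming from
  the quadratic term.\<close>

definition logistic :: "real \<Rightarrow> real" where
  "logistic x = exp x / (1 + exp x)"

lemma one_plus_exp_pos: "1 + exp x > (0::real)"
  by (simp add: add_pos_pos)

lemma logistic_nonneg: "0 \<le> logistic x" and logistic_le_1: "logistic x \<le> 1"
  using one_plus_exp_pos[of x] by (auto simp: logistic_def)

lemma one_minus_logistic: "1 - logistic x = 1 / (1 + exp x)"
  using one_plus_exp_pos[of x] by (simp add: logistic_def field_simps)

lemma DERIV_softplus: "((\<lambda>x. ln (1 + exp x)) has_real_derivative logistic x) (at x)"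
  unfolding logistic_def
  by (rule derivative_eq_intros refl one_plus_exp_pos | simp)+

lemma DERIV_logistic:
  "(logistic has_real_derivative logistic x * (1 - logistic x)) (at x)"
proof -
  have nz: "1 + exp x \<noteq> 0"
    using one_plus_exp_pos[of x] by simp
  have "((\<lambda>x. exp x / (1 + exp x)) has_real_derivative
      (exp x * (1 + exp x) - exp x * exp x) / ((1 + exp x) * (1 + exp x))) (at x)"
    using nz by (auto intro!: derivative_eq_intros)
  also have "(exp x * (1 + exp x) - exp x * exp x) / ((1 + exp x) * (1 + exp x)) =
      logistic x * (1 - logistic x)"
    by (simp add: one_minus_logistic, simp add: logistic_def algebra_simps)
  finally show ?thesis
    by (simp add: logistic_def[abs_def])
qed

lemma convex_on_softplus: "convex_on UNIV (\<lambda>x::real. ln (1 + exp x))"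
proof (rule f''_ge0_imp_convex)
  show "convex (UNIV :: real set)" by simp
  show "((\<lambda>x. ln (1 + exp x)) has_real_derivative logistic x) (at x)" for x
    by (rule DERIV_softplus)
  show "(logistic has_real_derivative logistic x * (1 - logistic x)) (at x)" for x
    by (rule DERIV_logistic)
  show "logistic x * (1 - logistic x) \<ge> 0" for x
    by (simp add: logistic_nonneg logistic_le_1)
qed

text \<open>The term \<open>m / 2 * x\<^sup>2\<close> satisfies the strong convexity inequality with
  equality, so adding the convexity inequality of \<open>g\<close> is enough.\<close>

lemma strongly_convex_add_square:
  fixes g :: "real \<Rightarrow> real"
  assumes "convex_on UNIV g" and "m > 0"
  shows "strongly_convex m (\<lambda>x. g x + m / 2 * x\<^sup>2)"
  unfolding strongly_convex_def
proof (intro conjI allI impI)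
  fix x y u v :: real
  assume uv: "0 \<le> u" "0 \<le> v" "u + v = 1"
  have "g (u * x + v * y) \<le> u * g x + v * g y"
    \<comment> \<open>\<open>convex_onD\<close> puts the weight \<open>1 - t\<close> on the first
      point; here \<open>t\<close> is \<open>v\<close>, so that weight is \<open>u\<close>.\<close>
    using convex_onD[OF assms(1), of v x y] uv by (simp add: eq_diff_eq[symmetric])
  moreover have "m / 2 * (u * x + v * y)\<^sup>2 =
      u * (m / 2 * x\<^sup>2) + v * (m / 2 * y\<^sup>2) - m / 2 * u * v * (x - y)\<^sup>2"
  proof -
    have v: "v = 1 - u" using uv by simp
    show ?thesis unfolding v by (simp add: power2_eq_square field_simps)
  qed
  ultimately show "g (u *\<^sub>R x + v *\<^sub>R y) + m / 2 * (u *\<^sub>R x + v *\<^sub>R y)\<^sup>2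
      \<le> u * (g x + m / 2 * x\<^sup>2) + v * (g y + m / 2 * y\<^sup>2) - m / 2 * u * v * (norm (x - y))\<^sup>2"
    by (simp add: distrib_left add_divide_distrib diff_divide_distrib)
qed (fact assms(2))

text \<open>The squared norm on the left of the cocoercivity inequality is nonnegative, and the
  positive factor \<open>l\<close> can be cancelled.\<close>

lemma cocoercive_imp_monotone_operator:
  assumes "cocoercive l G" and "l > 0"
  shows "monotone_operator G"
  unfolding monotone_operator_def
proof (intro allI)
  fix x x'
  have "0 \<le> l * ((G x - G x') \<bullet> (x - x'))"
    using assms(1) unfolding cocoercive_def by (meson order_trans zero_le_power2)
  then show "(G x - G x') \<bullet> (x - x') \<ge> 0"
    using assms(2) by (simp add: zero_le_mult_iff)
qed

text \<open>On the reals the inner product is multiplication, and for nondecreasing \<open>G\<close>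
  the two differences never have opposite signs.\<close>

lemma mono_imp_monotone_operator:
  fixes G :: "real \<Rightarrow> real"
  assumes "mono G"
  shows "monotone_operator G"
  unfolding monotone_operator_def
proof (intro allI)
  fix x y :: real
  show "(G x - G y) \<bullet> (x - y) \<ge> 0"
    using monoD[OF assms, of x y] monoD[OF assms, of y x]
    by (cases "x \<le> y") (auto simp: zero_le_mult_iff)
qed

theorem theoremF3:
  fixes f F :: "real \<Rightarrow> real"
  assumes f: "\<And>x. f x = ln (1 + exp x) + x\<^sup>2 / 200"
    and F: "F = deriv f"
  shows "(\<exists>m. strongly_convex m f) \<and> (\<exists>L. L_smooth L f) \<and>
    monotone_operator F \<and> (\<exists>L. L-lipschitz_on UNIV F) \<and>
    (\<forall>x. F field_differentiable at x) \<and>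
    (\<forall>l>0. \<not> cocoercive l (hamiltonian_operator F))"
proof -
  define F' where "F' x = logistic x * (1 - logistic x) + 1 / 100" for x
  \<comment> \<open>The coefficient \<open>1 / 200\<close> is split as \<open>(1 / 100) / 2\<close>
    to match \<open>strongly_convex_add_square\<close> with modulus \<open>1 / 100\<close>.\<close>
  have f_eq: "f = (\<lambda>x. ln (1 + exp x) + (1 / 100) / 2 * x\<^sup>2)"
    by (simp add: f fun_eq_iff)
  have derf: "(f has_real_derivative logistic x + x / 100) (at x)" for x
    unfolding f_eq by (rule derivative_eq_intros DERIV_softplus refl | simp)+
  have F_eq: "F = (\<lambda>x. logistic x + x / 100)"
    using DERIV_imp_deriv[OF derf] F by auto
  have derF: "(F has_real_derivative F' x) (at x)" for x
    unfolding F_eq F'_def by (rule derivative_eq_intros DERIV_logistic refl | simp)+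
  have F'_nonneg: "0 \<le> F' x" for x
    by (simp add: F'_def logistic_nonneg logistic_le_1)
  \<comment> \<open>A crude bound: a product of two numbers in \<open>[0, 1]\<close> is at most
    \<open>1\<close>. Any finite bound would give a Lipschitz constant.\<close>
  have F'_le: "F' x \<le> 2" for x
    using mult_le_one[of "logistic x" "1 - logistic x"] logistic_nonneg[of x] logistic_le_1[of x]
    by (simp add: F'_def)

  have strong: "strongly_convex (1 / 100) f"
    unfolding f_eq by (rule strongly_convex_add_square[OF convex_on_softplus]) simp
  have lip: "2-lipschitz_on UNIV F"
    \<comment> \<open>The derivative is taken as the linear map that multiplies by
      \<open>F' x\<close>; its operator norm is at most \<open>2\<close> because
      \<open>0 \<le> F' x \<le> 2\<close>.\<close>
    by (rule bounded_derivative_imp_lipschitz[where f' = "\<lambda>x. (*) (F' x)"])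
       (auto simp: has_field_derivative_imp_has_derivative[OF derF] F'_nonneg F'_le
         intro!: onorm_le mult_right_mono simp: abs_mult)
  have smooth: "L_smooth 2 f"
    using lip derf F by (auto simp: L_smooth_def field_differentiable_def)
  have "mono F"
    by (rule monoI, rule DERIV_nonneg_imp_nondecreasing) (use derF F'_nonneg in auto)
  then have mon: "monotone_operator F"
    by (rule mono_imp_monotone_operator)
  have diff: "\<forall>x. F field_differentiable at x"
    using derF by (auto simp: field_differentiable_def)

  have H: "hamiltonian_operator F x = F' x * F x" for x
    by (simp add: hamiltonian_operator_def DERIV_imp_deriv[OF derF])
  \<comment> \<open>Since \<open>logistic 0 = 1 / 2\<close>, the factors are
    \<open>F' 0 = 1 / 4 + 1 / 100 = 26 / 100\<close> and \<open>F 0 = 1 / 2\<close>.\<close>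
  have H0: "hamiltonian_operator F 0 = 13 / 100"
    unfolding H by (simp add: F'_def F_eq logistic_def)
  have H100: "hamiltonian_operator F 100 \<le> 4 / 100"
  proof -
    \<comment> \<open>The tangent bound \<open>exp 100 \<ge> 101\<close> already suffices: it makes
      the logistic part of \<open>F' 100\<close> at most \<open>1 / 100\<close>, no larger than the
      quadratic part. Hence \<open>F' 100 \<le> 2 / 100\<close>, while
      \<open>F 100 = logistic 100 + 1 \<le> 2\<close>.\<close>
    have "1 - logistic 100 \<le> 1 / 100"
      unfolding one_minus_logistic using exp_ge_add_one_self[of 100]
      by (intro divide_left_mono) auto
    then have "logistic 100 * (1 - logistic 100) \<le> 1 * (1 / 100)"
      by (intro mult_mono) (auto simp: logistic_nonneg logistic_le_1)
    then have "F' 100 * F 100 \<le> 2 / 100 * 2"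
      by (intro mult_mono) (auto simp: F'_def F_eq logistic_nonneg logistic_le_1)
    then show ?thesis by (simp add: H)
  qed
  \<comment> \<open>The first factor is at least \<open>9 / 100\<close> and the second is
    negative.\<close>
  have "(hamiltonian_operator F 0 - hamiltonian_operator F 100) \<bullet> (0 - 100) < 0"
    using H0 H100 by simp
  then have "\<not> monotone_operator (hamiltonian_operator F)"
    unfolding monotone_operator_def by (meson not_le)
  then have "\<forall>l>0. \<not> cocoercive l (hamiltonian_operator F)"
    using cocoercive_imp_monotone_operator by blast
  with strong smooth mon lip diff show ?thesis
    by blast
qed

end
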